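(* Let $k$ be a positive semi-definite kernel on a metric measure space $\mathcal{M}$ with reproducing kernel Hilbert space $\mathcal{H}_k$, and let $f$ be a Gaussian process with covariance $k$. Let $\mathcal{X}\subseteq\mathcal{M}$ be compact (with finite measure), and let $\tilde f$ be a (fixed) standard normal Bayesian linear model with $\ell$ basis functions $\phi_1,\dots,\phi_\ell$, each of which lies locally in $\mathcal{H}_k$ for $\mathcal{X}$. For a finite set $X_n\subset\mathcal{X}$ of $n$ points with $K_{n,n}=k(X_n,X_n)$ invertible and $y\in\mathbb{R}^n$, define $$(f\mid y)(\cdot)=f(\cdot)+k(\cdot,X_n)K_{n,n}^{-1}(y-f(X_n)),\qquad (\tilde f\mid y)(\cdot)=\tilde f(\cdot)+k(\cdot,X_n)K_{n,n}^{-1}(y-\tilde f(X_n)).$$ Then, along any sequence of such finite sets $X_n$ (and vectors $y$) for which $\sup_{x\in\mathcal{X}}k^{(f\mid y)}(x,x)\to0$, one has $$\sup_{x,x'\in\mathcal{X}}\bigl|k^{(\tilde f\mid y)}(x,x')-k^{(f\mid y)}(x,x')\bigr|\to0 .$$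
   Context: A standard normal Bayesian linear model is a random function $\tilde f(\cdot)=\sum_{i=1}^\ell w_i\phi_i(\cdot)$ with i.i.d. $w_i\sim\mathcal{N}(0,1)$ and linearly independent (deterministic) basis functions $\phi_i:\mathcal{M}\to\mathbb{R}$. A function $\phi_i$ lies locally in $\mathcal{H}_k$ for $\mathcal{X}$ if there is $\psi\in\mathcal{H}_k$ with $\psi|_{\mathcal{X}}=\phi_i|_{\mathcal{X}}$. For $X_n=(x_1,\dots,x_n)$: $k(\cdot,X_n)=(k(\cdot,x_1),\dots,k(\cdot,x_n))$, $k(X_n,X_n)=(k(x_i,x_j))_{i,j}$, $f(X_n)=(f(x_1),\dots,f(x_n))^\top$. The process $f\mid y$ is (in distribution) $f$ conditioned on the noise-free observations $f(X_n)=y$; $\tilde f\mid y$ applies the same update (with the true kernel $k$) to $\tilde f$. $k^{(f\mid y)}$ and $k^{(\tilde f\mid y)}$ denote the covariance functions of $f\mid y$ and $\tilde f\mid y$, respectively; in particular $k^{(f\mid y)}(x,x')=k(x,x')-k(x,X_n)K_{n,n}^{-1}k(X_n,x')$. *)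

theory Defs
  imports
    "HOL-Probability.Probability"
    "Jordan_Normal_Form.Gauss_Jordan_Elimination"
begin

subsection \<open>Kernels and reproducing kernel Hilbert spaces\<close>

definition psd_kernel :: "('m \<Rightarrow> 'm \<Rightarrow> real) \<Rightarrow> bool" where
  "psd_kernel k \<longleftrightarrow>
     (\<forall>x x'. k x x' = k x' x) \<and>
     (\<forall>(n::nat) (c :: nat \<Rightarrow> real) (x :: nat \<Rightarrow> 'm).
        0 \<le> (\<Sum>i<n. \<Sum>j<n. c i * c j * k (x i) (x j)))"

text \<open>A real Hilbert space of functions is given by its carrier \<open>H\<close> and its inner product \<open>ip\<close>,
  whose values are only relevant on \<open>H\<close>.\<close>

definition function_hilbert_space ::
    "('m \<Rightarrow> real) set \<Rightarrow> (('m \<Rightarrow> real) \<Rightarrow> ('m \<Rightarrow> real) \<Rightarrow> real) \<Rightarrow> bool" where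
  "function_hilbert_space H ip \<longleftrightarrow>
     (\<lambda>_. 0) \<in> H \<and>
     (\<forall>g\<in>H. \<forall>h\<in>H. (\<lambda>z. g z + h z) \<in> H) \<and>
     (\<forall>a. \<forall>g\<in>H. (\<lambda>z. a * g z) \<in> H) \<and>
     (\<forall>g\<in>H. \<forall>h\<in>H. ip g h = ip h g) \<and>
     (\<forall>g\<in>H. \<forall>g'\<in>H. \<forall>h\<in>H. ip (\<lambda>z. g z + g' z) h = ip g h + ip g' h) \<and>
     (\<forall>a. \<forall>g\<in>H. \<forall>h\<in>H. ip (\<lambda>z. a * g z) h = a * ip g h) \<and>
     (\<forall>g\<in>H. 0 \<le> ip g g) \<and>
     (\<forall>g\<in>H. ip g g = 0 \<longrightarrow> g = (\<lambda>_. 0)) \<and>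
     (\<forall>s :: nat \<Rightarrow> 'm \<Rightarrow> real.
        (\<forall>n. s n \<in> H) \<longrightarrow>
        (\<forall>e>0. \<exists>N. \<forall>m\<ge>N. \<forall>n\<ge>N. sqrt (ip (\<lambda>z. s m z - s n z) (\<lambda>z. s m z - s n z)) < e) \<longrightarrow>
        (\<exists>g\<in>H. (\<lambda>n. sqrt (ip (\<lambda>z. s n z - g z) (\<lambda>z. s n z - g z))) \<longlonglongrightarrow> 0))"

text \<open>The reproducing kernel Hilbert space of a positive semi-definite kernel exists and is unique
  (Moore--Aronszajn), so this predicate determines \<open>H\<close>, and \<open>ip\<close> on \<open>H\<close>.\<close>

definition is_rkhs :: "('m \<Rightarrow> 'm \<Rightarrow> real) \<Rightarrow>
    ('m \<Rightarrow> real) set \<Rightarrow> (('m \<Rightarrow> real) \<Rightarrow> ('m \<Rightarrow> real) \<Rightarrow> real) \<Rightarrow> bool" where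
  "is_rkhs k H ip \<longleftrightarrow>
     function_hilbert_space H ip \<and>
     (\<forall>x. (\<lambda>z. k z x) \<in> H) \<and>
     (\<forall>g\<in>H. \<forall>x. ip g (\<lambda>z. k z x) = g x)"

definition lies_locally_in ::
    "('m \<Rightarrow> real) set \<Rightarrow> 'm set \<Rightarrow> ('m \<Rightarrow> real) \<Rightarrow> bool" where
  "lies_locally_in H X \<phi> \<longleftrightarrow> (\<exists>\<psi>\<in>H. \<forall>x\<in>X. \<psi> x = \<phi> x)"

subsection \<open>Random functions\<close>

text \<open>A random function on \<open>'m\<close> over the probability space \<open>P\<close> is a family
  \<open>f x :: 'w \<Rightarrow> real\<close> of random variables.\<close>

definition cov :: "'w measure \<Rightarrow> ('w \<Rightarrow> real) \<Rightarrow> ('w \<Rightarrow> real) \<Rightarrow> real" where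
  "cov P U V = (LINT \<omega>|P. (U \<omega> - integral\<^sup>L P U) * (V \<omega> - integral\<^sup>L P V))"

definition cov_fun :: "'w measure \<Rightarrow> ('m \<Rightarrow> 'w \<Rightarrow> real) \<Rightarrow> 'm \<Rightarrow> 'm \<Rightarrow> real" where
  "cov_fun P f x x' = cov P (f x) (f x')"

text \<open>Almost surely constant random variables count as Gaussian (variance zero).\<close>

definition gaussian_rv :: "'w measure \<Rightarrow> ('w \<Rightarrow> real) \<Rightarrow> bool" where
  "gaussian_rv P U \<longleftrightarrow>
     U \<in> borel_measurable P \<and>
     (\<exists>m. (AE \<omega> in P. U \<omega> = m) \<or> (\<exists>\<sigma>>0. distributed P lborel U (normal_density m \<sigma>)))"

definition gaussian_process :: "'w measure \<Rightarrow> ('m \<Rightarrow> 'w \<Rightarrow> real) \<Rightarrow> bool" where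
  "gaussian_process P f \<longleftrightarrow>
     (\<forall>(n::nat) (c :: nat \<Rightarrow> real) (x :: nat \<Rightarrow> 'm).
        gaussian_rv P (\<lambda>\<omega>. \<Sum>i<n. c i * f (x i) \<omega>))"

definition standard_normal_blm :: "'w measure \<Rightarrow> nat \<Rightarrow> (nat \<Rightarrow> 'm \<Rightarrow> real) \<Rightarrow>
    ('m \<Rightarrow> 'w \<Rightarrow> real) \<Rightarrow> bool" where
  "standard_normal_blm P l \<phi> F \<longleftrightarrow>
     (\<forall>c :: nat \<Rightarrow> real. (\<forall>x. (\<Sum>i<l. c i * \<phi> i x) = 0) \<longrightarrow> (\<forall>i<l. c i = 0)) \<and>
     (\<exists>w :: nat \<Rightarrow> 'w \<Rightarrow> real.
        prob_space.indep_vars P (\<lambda>_. borel) w {..<l} \<and>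
        (\<forall>i<l. distributed P lborel (w i) std_normal_density) \<and>
        F = (\<lambda>x \<omega>. \<Sum>i<l. w i \<omega> * \<phi> i x))"

subsection \<open>Conditioning on noise-free observations\<close>

text \<open>Finite point sets are enumerated by distinct lists \<open>xs\<close>.\<close>

definition kernel_matrix :: "('m \<Rightarrow> 'm \<Rightarrow> real) \<Rightarrow> 'm list \<Rightarrow> real mat" where
  "kernel_matrix k xs = mat (length xs) (length xs) (\<lambda>(i, j). k (xs ! i) (xs ! j))"

definition kernel_vec :: "('m \<Rightarrow> 'm \<Rightarrow> real) \<Rightarrow> 'm \<Rightarrow> 'm list \<Rightarrow> real vec" where
  "kernel_vec k x xs = Matrix.vec (length xs) (\<lambda>i. k x (xs ! i))"

definition observe :: "('m \<Rightarrow> 'w \<Rightarrow> real) \<Rightarrow> 'm list \<Rightarrow> 'w \<Rightarrow> real vec" where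
  "observe f xs \<omega> = Matrix.vec (length xs) (\<lambda>i. f (xs ! i) \<omega>)"

text \<open>The inverse matrix below is only meaningful if the kernel matrix is invertible.\<close>

definition conditioned :: "('m \<Rightarrow> 'm \<Rightarrow> real) \<Rightarrow> 'm list \<Rightarrow> real vec \<Rightarrow>
    ('m \<Rightarrow> 'w \<Rightarrow> real) \<Rightarrow> 'm \<Rightarrow> 'w \<Rightarrow> real" where
  "conditioned k xs y f x \<omega> =
     f x \<omega> + scalar_prod (kernel_vec k x xs)
       (the (mat_inverse (kernel_matrix k xs)) *\<^sub>v (y - observe f xs \<omega>))"

end

theory Submission
  imports Defs
begin

text \<open>Both posteriors apply the same weights \<open>\<beta>\<^sub>j(x)\<close> to the observations. With
  \<open>r\<^sub>x = k(\<cdot>,x) - \<Sum>\<^sub>j \<beta>\<^sub>j(x) k(\<cdot>,x\<^sub>j)\<close>, bilinearity of the covariance and the reproducing property give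
  \<open>\<langle>r\<^sub>x, r\<^sub>x\<^sub>'\<rangle>\<close> for the posterior covariance of the Gaussian process and
  \<open>\<Sum>\<^sub>i \<langle>\<psi>\<^sub>i, r\<^sub>x\<rangle> \<langle>\<psi>\<^sub>i, r\<^sub>x\<^sub>'\<rangle>\<close> for that of the linear model, where \<open>\<psi>\<^sub>i\<close> represents \<open>\<phi>\<^sub>i\<close> in the RKHS.
  By Cauchy--Schwarz both are controlled by \<open>sup\<^sub>x \<parallel>r\<^sub>x\<parallel>\<^sup>2\<close>, the maximal posterior variance.
  Which weights are used plays no role.\<close>

section \<open>Algebra and Cauchy--Schwarz in a Hilbert space of functions\<close>

lemma function_hilbert_spaceD:
  assumes "function_hilbert_space H ip"
  shows "(\<lambda>_. 0) \<in> H"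
    and "g \<in> H \<Longrightarrow> h \<in> H \<Longrightarrow> (\<lambda>z. g z + h z) \<in> H"
    and "g \<in> H \<Longrightarrow> (\<lambda>z. a * g z) \<in> H"
    and "g \<in> H \<Longrightarrow> h \<in> H \<Longrightarrow> ip g h = ip h g"
    and "g \<in> H \<Longrightarrow> g' \<in> H \<Longrightarrow> h \<in> H \<Longrightarrow> ip (\<lambda>z. g z + g' z) h = ip g h + ip g' h"
    and "g \<in> H \<Longrightarrow> h \<in> H \<Longrightarrow> ip (\<lambda>z. a * g z) h = a * ip g h"
    and "g \<in> H \<Longrightarrow> 0 \<le> ip g g"
    and "g \<in> H \<Longrightarrow> ip g g = 0 \<Longrightarrow> g = (\<lambda>_. 0)"
proof -
  note d1 = assms[unfolded function_hilbert_space_def]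
  note d2 = conjunct2[OF d1]
  note d3 = conjunct2[OF d2]
  note d4 = conjunct2[OF d3]
  note d5 = conjunct2[OF d4]
  note d6 = conjunct2[OF d5]
  note d7 = conjunct2[OF d6]
  note d8 = conjunct2[OF d7]
  show "(\<lambda>_. 0) \<in> H"
    by (rule conjunct1[OF d1, rule_format])
  show "g \<in> H \<Longrightarrow> h \<in> H \<Longrightarrow> (\<lambda>z. g z + h z) \<in> H"
    by (rule conjunct1[OF d2, rule_format])
  show "g \<in> H \<Longrightarrow> (\<lambda>z. a * g z) \<in> H"
    by (rule conjunct1[OF d3, rule_format])
  show "g \<in> H \<Longrightarrow> h \<in> H \<Longrightarrow> ip g h = ip h g"
    by (rule conjunct1[OF d4, rule_format])
  show "g \<in> H \<Longrightarrow> g' \<in> H \<Longrightarrow> h \<in> H \<Longrightarrow> ip (\<lambda>z. g z + g' z) h = ip g h + ip g' h"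
    by (rule conjunct1[OF d5, rule_format])
  show "g \<in> H \<Longrightarrow> h \<in> H \<Longrightarrow> ip (\<lambda>z. a * g z) h = a * ip g h"
    by (rule conjunct1[OF d6, rule_format])
  show "g \<in> H \<Longrightarrow> 0 \<le> ip g g"
    by (rule conjunct1[OF d7, rule_format])
  show "g \<in> H \<Longrightarrow> ip g g = 0 \<Longrightarrow> g = (\<lambda>_. 0)"
    by (rule conjunct1[OF d8, rule_format])
qed

text \<open>Both claims go through one induction, because additivity of \<open>ip\<close> can be
  applied only once the partial sum is known to lie in \<open>H\<close>.\<close>

lemma function_hilbert_space_lincomb:
  assumes H: "function_hilbert_space H ip" and "finite I"
    and "\<And>i. i \<in> I \<Longrightarrow> g i \<in> H" and h: "h \<in> H"
  shows "(\<lambda>z. \<Sum>i\<in>I. a i * g i z) \<in> H"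
    and "ip (\<lambda>z. \<Sum>i\<in>I. a i * g i z) h = (\<Sum>i\<in>I. a i * ip (g i) h)"
proof -
  have "(\<lambda>z. \<Sum>i\<in>I. a i * g i z) \<in> H \<and>
      ip (\<lambda>z. \<Sum>i\<in>I. a i * g i z) h = (\<Sum>i\<in>I. a i * ip (g i) h)"
    using assms(2,3)
  proof (induction I rule: finite_induct)
    case empty
    show ?case
      \<comment> \<open>The zero function is written as \<open>0 * h\<close>, so its inner product
        with \<open>h\<close> is \<open>0 * ip h h\<close>.\<close>
      using function_hilbert_spaceD(1)[OF H] function_hilbert_spaceD(6)[OF H h h, of 0] by simp
  next
    case (insert j J)
    let ?s = "\<lambda>z. \<Sum>i\<in>J. a i * g i z"
    have s: "?s \<in> H" "ip ?s h = (\<Sum>i\<in>J. a i * ip (g i) h)"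
      using insert by auto
    have g: "g j \<in> H" using insert.prems by simp
    note j = function_hilbert_spaceD(3)[OF H g, of "a j"] function_hilbert_spaceD(6)[OF H g h, of "a j"]
    show ?case
      using function_hilbert_spaceD(2)[OF H j(1) s(1)] function_hilbert_spaceD(5)[OF H j(1) s(1) h]
        insert.hyps s j by simp
  qed
  then show "(\<lambda>z. \<Sum>i\<in>I. a i * g i z) \<in> H"
    and "ip (\<lambda>z. \<Sum>i\<in>I. a i * g i z) h = (\<Sum>i\<in>I. a i * ip (g i) h)" by auto
qed

text \<open>The squared norm of \<open>g + t * h\<close> is a nonnegative quadratic polynomial in
  \<open>t\<close>; evaluating it at its minimiser gives the squared inequality.\<close>

lemma function_hilbert_space_Cauchy_Schwarz:
  assumes H: "function_hilbert_space H ip" and g: "g \<in> H" and h: "h \<in> H"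
  shows "\<bar>ip g h\<bar> \<le> sqrt (ip g g) * sqrt (ip h h)"
proof -
  note add_H = function_hilbert_spaceD(2)[OF H] and scale_H = function_hilbert_spaceD(3)[OF H]
    and comm = function_hilbert_spaceD(4)[OF H] and add = function_hilbert_spaceD(5)[OF H]
    and scale = function_hilbert_spaceD(6)[OF H] and pos = function_hilbert_spaceD(7)[OF H]
  have quad: "0 \<le> ip g g + 2 * t * ip g h + t\<^sup>2 * ip h h" for t
  proof -
    let ?u = "\<lambda>z. t * h z"
    let ?v = "\<lambda>z. g z + ?u z"
    have u: "?u \<in> H" and v: "?v \<in> H" using add_H scale_H g h by auto
    have "ip ?v ?v = ip g ?v + ip ?u ?v" using add[OF g u v] .
    also have "ip g ?v = ip g g + t * ip g h"
      using comm[OF g v] add[OF g u g] scale[OF h g] comm[OF g h] by simp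
    also have "ip ?u ?v = t * (ip g h + t * ip h h)"
      using scale[OF h v] comm[OF h v] add[OF g u h] scale[OF h h] by simp
    finally show ?thesis using pos[OF v] by (simp add: algebra_simps power2_eq_square)
  qed
  have "(ip g h)\<^sup>2 \<le> ip g g * ip h h"
  proof (cases "ip h h = 0")
    case True
    \<comment> \<open>A vector of norm zero vanishes by definiteness, so both sides of the
      inequality are zero.\<close>
    then have "h = (\<lambda>_. 0)" by (rule function_hilbert_spaceD(8)[OF H h])
    then have "ip h g = 0" using scale[OF h g, of 0] by simp
    then show ?thesis using comm[OF g h] True by simp
  next
    case False
    then have "0 < ip h h" using pos[OF h] by simp
    then show ?thesis
      \<comment> \<open>This value of \<open>t\<close> minimises the quadratic.\<close>
      using quad[of "- ip g h / ip h h"] by (simp add: field_simps power2_eq_square)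
  qed
  then show ?thesis
    by (metis real_sqrt_abs real_sqrt_le_iff real_sqrt_mult)
qed

section \<open>Second moments and bilinearity of the covariance\<close>

lemma integrable_mult_of_square_integrable:
  fixes U V :: "'a \<Rightarrow> real"
  assumes [measurable]: "U \<in> borel_measurable P" "V \<in> borel_measurable P"
    and "integrable P (\<lambda>\<omega>. (U \<omega>)\<^sup>2)" "integrable P (\<lambda>\<omega>. (V \<omega>)\<^sup>2)"
  shows "integrable P (\<lambda>\<omega>. U \<omega> * V \<omega>)"
proof (rule Bochner_Integration.integrable_bound)
  show "integrable P (\<lambda>\<omega>. (U \<omega>)\<^sup>2 + (V \<omega>)\<^sup>2)" using assms by simp
  have "\<bar>a * b\<bar> \<le> a\<^sup>2 + b\<^sup>2" for a b :: real
  proof -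
    have "0 \<le> (\<bar>a\<bar> - \<bar>b\<bar>)\<^sup>2" "0 \<le> \<bar>a\<bar> * \<bar>b\<bar>" by simp_all
    then show ?thesis unfolding power2_diff power2_abs abs_mult by linarith
  qed
  then show "AE \<omega> in P. norm (U \<omega> * V \<omega>) \<le> norm ((U \<omega>)\<^sup>2 + (V \<omega>)\<^sup>2)" by simp
qed simp

text \<open>Centring removes the constants \<open>c\<close> and \<open>d\<close>, which will carry
  the observed values. Square integrability makes every product of centred variables integrable, so
  that sums and expectations may be interchanged.\<close>

lemma cov_lincomb:
  assumes "prob_space P" and "finite I" "finite J"
    and U: "\<And>i. i \<in> I \<Longrightarrow> U i \<in> borel_measurable P" "\<And>i. i \<in> I \<Longrightarrow> integrable P (\<lambda>\<omega>. (U i \<omega>)\<^sup>2)"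
    and V: "\<And>j. j \<in> J \<Longrightarrow> V j \<in> borel_measurable P" "\<And>j. j \<in> J \<Longrightarrow> integrable P (\<lambda>\<omega>. (V j \<omega>)\<^sup>2)"
  shows "cov P (\<lambda>\<omega>. c + (\<Sum>i\<in>I. a i * U i \<omega>)) (\<lambda>\<omega>. d + (\<Sum>j\<in>J. b j * V j \<omega>))
    = (\<Sum>i\<in>I. \<Sum>j\<in>J. a i * b j * cov P (U i) (V j))"
proof -
  interpret prob_space P by fact
  define Uc where "Uc i \<omega> = U i \<omega> - expectation (U i)" for i \<omega>
  define Vc where "Vc j \<omega> = V j \<omega> - expectation (V j)" for j \<omega>
  have intU: "integrable P (U i)" if "i \<in> I" for i
    using square_integrable_imp_integrable U that by blast
  have intV: "integrable P (V j)" if "j \<in> J" for j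
    using square_integrable_imp_integrable V that by blast
  have EU: "expectation (\<lambda>\<omega>. c + (\<Sum>i\<in>I. a i * U i \<omega>)) = c + (\<Sum>i\<in>I. a i * expectation (U i))"
    using intU by (simp add: Bochner_Integration.integral_add Bochner_Integration.integral_sum prob_space)
  have EV: "expectation (\<lambda>\<omega>. d + (\<Sum>j\<in>J. b j * V j \<omega>)) = d + (\<Sum>j\<in>J. b j * expectation (V j))"
    using intV by (simp add: Bochner_Integration.integral_add Bochner_Integration.integral_sum prob_space)
  have int: "integrable P (\<lambda>\<omega>. Uc i \<omega> * Vc j \<omega>)" if "i \<in> I" "j \<in> J" for i j
  proof (rule integrable_mult_of_square_integrable)
    show "Uc i \<in> borel_measurable P" "Vc j \<in> borel_measurable P"
      using U(1) V(1) that by (auto simp: Uc_def[abs_def] Vc_def[abs_def])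
    show "integrable P (\<lambda>\<omega>. (Uc i \<omega>)\<^sup>2)" "integrable P (\<lambda>\<omega>. (Vc j \<omega>)\<^sup>2)"
      using U(2) V(2) intU intV that by (auto simp: Uc_def Vc_def power2_diff)
  qed
  have "cov P (\<lambda>\<omega>. c + (\<Sum>i\<in>I. a i * U i \<omega>)) (\<lambda>\<omega>. d + (\<Sum>j\<in>J. b j * V j \<omega>))
      = expectation (\<lambda>\<omega>. (\<Sum>i\<in>I. a i * Uc i \<omega>) * (\<Sum>j\<in>J. b j * Vc j \<omega>))"
    unfolding cov_def EU EV Uc_def Vc_def by (simp add: sum_subtractf right_diff_distrib)
  also have "\<dots> = expectation (\<lambda>\<omega>. \<Sum>i\<in>I. \<Sum>j\<in>J. a i * b j * (Uc i \<omega> * Vc j \<omega>))"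
    by (simp add: sum_product mult_ac)
  also have "\<dots> = (\<Sum>i\<in>I. \<Sum>j\<in>J. a i * b j * expectation (\<lambda>\<omega>. Uc i \<omega> * Vc j \<omega>))"
    using int by (simp add: Bochner_Integration.integral_sum)
  finally show ?thesis unfolding cov_def Uc_def Vc_def .
qed

text \<open>The density gives integrability of the centred square (U - m)^2. The rest is U^2 = (U -
  m)^2 + 2m(U - m) + m^2, where the linear term is integrable because its square is.\<close>

lemma square_integrable_normal:
  assumes "prob_space P" and \<sigma>: "0 < \<sigma>" and D: "distributed P lborel U (normal_density m \<sigma>)"
  shows "integrable P (\<lambda>\<omega>. (U \<omega>)\<^sup>2)"
proof -
  interpret prob_space P by fact
  have [measurable]: "U \<in> borel_measurable P"
    using distributed_measurable[OF D] by simp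
  have "integrable P (\<lambda>\<omega>. (U \<omega> - m)\<^sup>2)"
    using distributed_integrable[OF D, of "\<lambda>x. (x - m)\<^sup>2"] integrable_normal_moment[OF \<sigma>, of m 2]
    by simp
  moreover from this have "integrable P (\<lambda>\<omega>. U \<omega> - m)"
    by (rule square_integrable_imp_integrable[rotated]) simp
  ultimately have "integrable P (\<lambda>\<omega>. (U \<omega> - m)\<^sup>2 + 2 * m * (U \<omega> - m) + m\<^sup>2)"
    by simp
  then show ?thesis by (simp add: power2_eq_square algebra_simps)
qed

lemma square_integrable_gaussian_rv:
  assumes "prob_space P" and U: "gaussian_rv P U"
  shows "integrable P (\<lambda>\<omega>. (U \<omega>)\<^sup>2)"
proof -
  interpret prob_space P by fact
  have [measurable]: "U \<in> borel_measurable P" using U by (simp add: gaussian_rv_def)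
  obtain m where "(AE \<omega> in P. U \<omega> = m) \<or> (\<exists>\<sigma>>0. distributed P lborel U (normal_density m \<sigma>))"
    using U by (auto simp: gaussian_rv_def)
  then show ?thesis
  proof
    assume "AE \<omega> in P. U \<omega> = m"
    then have "AE \<omega> in P. (U \<omega>)\<^sup>2 = m\<^sup>2" by auto
    then show ?thesis using integrable_cong_AE[of "\<lambda>\<omega>. (U \<omega>)\<^sup>2" P "\<lambda>_. m\<^sup>2"] by simp
  qed (use square_integrable_normal assms(1) in blast)
qed

lemma gaussian_process_marginal:
  assumes "gaussian_process P f"
  shows "gaussian_rv P (f x)"
  using assms[unfolded gaussian_process_def, rule_format, where n = 1 and c = "\<lambda>_. 1" and x = "\<lambda>_. x"]
  by simp

text \<open>The diagonal entries are the unit variances; off the diagonal, independence factors the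
  expectation of the product into two zero means.\<close>

lemma cov_indep_std_normal:
  assumes "prob_space Q" and ind: "prob_space.indep_vars Q (\<lambda>_. borel) w {..<l}"
    and D: "\<And>i. i < l \<Longrightarrow> distributed Q lborel (w i) std_normal_density" and "i < l" "j < l"
  shows "cov Q (w i) (w j) = (if i = j then 1 else 0)"
proof -
  interpret prob_space Q by fact
  have E: "expectation (w i) = 0" "expectation (w j) = 0"
    using standard_normal_distributed_expectation D assms by auto
  show ?thesis
  proof (cases "i = j")
    case True
    then show ?thesis
      using standard_normal_distributed_variance[OF D[OF \<open>j < l\<close>]]
      by (simp add: cov_def power2_eq_square)
  next
    case False
    have int: "integrable Q (w k)" if "k < l" for k
    proof (rule square_integrable_imp_integrable)
      show "w k \<in> borel_measurable Q"
        using distributed_measurable[OF D[OF that]] by simp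
      show "integrable Q (\<lambda>\<omega>. (w k \<omega>)\<^sup>2)"
        by (rule square_integrable_normal[OF assms(1) _ D[OF that]]) simp
    qed
    \<comment> \<open>Independence is stated for finite families, so the product of two variables is
      written over the set \<open>{i, j}\<close>, which has two elements here.\<close>
    have "expectation (\<lambda>\<omega>. \<Prod>k\<in>{i, j}. w k \<omega>) = (\<Prod>k\<in>{i, j}. expectation (w k))"
    proof (rule indep_vars_lebesgue_integral)
      show "indep_vars (\<lambda>_. borel) w {i, j}"
        by (rule indep_vars_subset[OF ind]) (simp add: assms(4,5))
      show "integrable Q (w k)" if "k \<in> {i, j}" for k
        using that assms(4,5) by (intro int) auto
    qed simp
    then show ?thesis using False by (simp add: cov_def E)
  qed
qed

section \<open>The conditioning update as an affine combination of point values\<close>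

text \<open>Invertibility makes \<open>A\<close> a unit of the matrix ring, which excludes the
  result \<open>None\<close>. Otherwise \<open>the\<close> would yield an unspecified matrix of
  unknown size.\<close>

lemma dim_row_mat_inverse:
  fixes A :: "real mat"
  assumes A: "A \<in> carrier_mat n n" and "invertible_mat A"
  shows "dim_row (the (mat_inverse A)) = n"
proof -
  obtain B where B: "A * B = 1\<^sub>m n" "B * A = 1\<^sub>m (dim_row B)"
    using assms by (auto simp: invertible_mat_def inverts_mat_def)
  \<comment> \<open>The shape of \<open>B\<close> is read off from the dimensions of the two
    identity matrices.\<close>
  then have "B \<in> carrier_mat n n"
    using A by (metis carrier_matD(2) carrier_matI index_mult_mat(2,3) index_one_mat(2,3))
  with A B have "A \<in> Units (ring_mat TYPE(real) n ())"
    by (auto simp: Units_def ring_mat_def)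
  with mat_inverse(1)[OF A] obtain C where C: "mat_inverse A = Some C"
    by (metis not_None_eq)
  then show ?thesis using mat_inverse(2)[OF A C] by auto
qed

text \<open>The point \<open>x\<close> itself is appended to the observed points as the point with index \<open>length xs\<close>,
  so that the residual becomes a single linear combination.\<close>

lemma conditioned_lincomb:
  assumes "invertible_mat (kernel_matrix k xs)" and "y \<in> carrier_vec (length xs)"
  obtains c a where
    "\<And>u :: 'm \<Rightarrow> real. u x + scalar_prod (kernel_vec k x xs)
        (the (mat_inverse (kernel_matrix k xs)) *\<^sub>v (y - Matrix.vec (length xs) (\<lambda>i. u (xs ! i))))
      = c + (\<Sum>i\<le>length xs. a i * u ((xs @ [x]) ! i))"
proof -
  let ?n = "length xs"
  define A where "A = the (mat_inverse (kernel_matrix k xs))"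
  have dim: "dim_row A = ?n"
    unfolding A_def by (rule dim_row_mat_inverse) (use assms in \<open>auto simp: kernel_matrix_def\<close>)
  have dimc: "dim_vec y = ?n" using assms(2) by simp
  \<comment> \<open>\<open>b\<close> is the row vector k(x, X_n) K^-1, and \<open>c\<close> is its
    pairing with the data. In \<open>a\<close> the observed points get weight \<open>- b i\<close>,
    and the last index \<open>?n\<close>, which stands for \<open>x\<close>, gets weight 1.\<close>
  define b where "b j = (\<Sum>i<?n. k x (xs ! i) * row A i $ j)" for j
  define c where "c = (\<Sum>j<?n. b j * y $ j)"
  define a where "a i = (if i < ?n then - b i else 1)" for i
  have "u x + scalar_prod (kernel_vec k x xs) (A *\<^sub>v (y - Matrix.vec ?n (\<lambda>i. u (xs ! i))))
      = c + (\<Sum>i\<le>?n. a i * u ((xs @ [x]) ! i))" for u :: "'m \<Rightarrow> real"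
  proof -
    have "scalar_prod (kernel_vec k x xs) (A *\<^sub>v (y - Matrix.vec ?n (\<lambda>i. u (xs ! i)))) =
        (\<Sum>i<?n. k x (xs ! i) * (\<Sum>j<?n. row A i $ j * (y $ j - u (xs ! j))))"
      by (simp add: scalar_prod_def kernel_vec_def dim dimc atLeast0LessThan)
    also have "\<dots> = (\<Sum>j<?n. b j * (y $ j - u (xs ! j)))"
      unfolding b_def sum_distrib_left sum_distrib_right by (subst sum.swap) (simp add: mult.assoc)
    finally have "scalar_prod (kernel_vec k x xs) (A *\<^sub>v (y - Matrix.vec ?n (\<lambda>i. u (xs ! i)))) =
        c - (\<Sum>j<?n. b j * u (xs ! j))"
      by (simp add: c_def right_diff_distrib sum_subtractf)
    moreover have "(\<Sum>i\<le>?n. a i * u ((xs @ [x]) ! i)) = u x - (\<Sum>j<?n. b j * u (xs ! j))"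
      by (simp add: lessThan_Suc_atMost[symmetric] a_def nth_append sum_negf)
    ultimately show ?thesis by simp
  qed
  with that show thesis unfolding A_def by blast
qed

section \<open>Residuals in the RKHS and the uniform covariance bound\<close>

theorem corollary8:
  fixes \<mu> :: "'m::metric_space measure"
    and k :: "'m \<Rightarrow> 'm \<Rightarrow> real"
    and H :: "('m \<Rightarrow> real) set"
    and ip :: "('m \<Rightarrow> real) \<Rightarrow> ('m \<Rightarrow> real) \<Rightarrow> real"
    and P :: "'w measure" and f :: "'m \<Rightarrow> 'w \<Rightarrow> real"
    and Q :: "'v measure" and ft :: "'m \<Rightarrow> 'v \<Rightarrow> real"
    and X :: "'m set"
    and l :: nat and \<phi> :: "nat \<Rightarrow> 'm \<Rightarrow> real"
    and xs :: "nat \<Rightarrow> 'm list" and y :: "nat \<Rightarrow> real vec"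
  assumes "sets \<mu> = sets borel"
    and "psd_kernel k"
    and "is_rkhs k H ip"
    and "prob_space P"
    and "gaussian_process P f"
    and "cov_fun P f = k"
    and "compact X"
    and "emeasure \<mu> X < \<infinity>"
    and "prob_space Q"
    and "standard_normal_blm Q l \<phi> ft"
    and "\<And>i. i < l \<Longrightarrow> lies_locally_in H X (\<phi> i)"
    and "\<And>n. distinct (xs n)"
    and "\<And>n. set (xs n) \<subseteq> X"
    and "\<And>n. invertible_mat (kernel_matrix k (xs n))"
    and "\<And>n. y n \<in> carrier_vec (length (xs n))"
    and "(\<lambda>n. SUP x\<in>X. ennreal (cov_fun P (conditioned k (xs n) (y n) f) x x)) \<longlonglongrightarrow> 0"
  shows "(\<lambda>n. SUP (x, x')\<in>X \<times> X.
           ennreal \<bar>cov_fun Q (conditioned k (xs n) (y n) ft) x x'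
                     - cov_fun P (conditioned k (xs n) (y n) f) x x'\<bar>) \<longlonglongrightarrow> 0"
proof -
  have H: "function_hilbert_space H ip" and kH: "\<And>x. (\<lambda>z. k z x) \<in> H"
    and repr: "\<And>g x. g \<in> H \<Longrightarrow> ip g (\<lambda>z. k z x) = g x"
    using assms(3) by (auto simp: is_rkhs_def)
  note comm = function_hilbert_spaceD(4)[OF H] and pos = function_hilbert_spaceD(7)[OF H]
  have "\<forall>i. \<exists>\<psi>. i < l \<longrightarrow> \<psi> \<in> H \<and> (\<forall>x\<in>X. \<psi> x = \<phi> i x)"
    using assms(11) unfolding lies_locally_in_def by blast
  from choice[OF this] obtain \<psi> where
    \<psi>': "\<forall>i. i < l \<longrightarrow> \<psi> i \<in> H \<and> (\<forall>x\<in>X. \<psi> i x = \<phi> i x)" ..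
  have \<psi>: "\<psi> i \<in> H" "x \<in> X \<Longrightarrow> \<psi> i x = \<phi> i x" if "i < l" for i x
    using \<psi>' that by simp_all
  obtain w where w: "prob_space.indep_vars Q (\<lambda>_. borel) w {..<l}"
      "\<And>i. i < l \<Longrightarrow> distributed Q lborel (w i) std_normal_density"
    and ft: "ft = (\<lambda>x \<omega>. \<Sum>i<l. w i \<omega> * \<phi> i x)"
    using assms(10) by (auto simp: standard_normal_blm_def)
  have w_meas: "w i \<in> borel_measurable Q" and w_sq: "integrable Q (\<lambda>\<omega>. (w i \<omega>)\<^sup>2)" if "i < l" for i
    using distributed_measurable[OF w(2)[OF that]]
      square_integrable_normal[OF assms(9) _ w(2)[OF that]] by auto
  have f_meas: "f x \<in> borel_measurable P" and f_sq: "integrable P (\<lambda>\<omega>. (f x \<omega>)\<^sup>2)" for x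
    using gaussian_process_marginal[OF assms(5)] square_integrable_gaussian_rv[OF assms(4)]
    by (auto simp: gaussian_rv_def)
  have cov_f: "cov P (f x) (f x') = k x x'" for x x'
    using assms(6) by (auto simp: cov_fun_def fun_eq_iff)
  \<comment> \<open>The 1 pays for the posterior covariance of the Gaussian process, the squared
    norms of the \<open>\<psi> i\<close> for that of the linear model.\<close>
  define C where "C = 1 + (\<Sum>i<l. ip (\<psi> i) (\<psi> i))"
  have C: "1 \<le> C" using pos \<psi>(1) by (auto simp: C_def intro: sum_nonneg)
  define v where "v n x = cov_fun P (conditioned k (xs n) (y n) f) x x" for n x
  \<comment> \<open>The truncation at zero by \<open>ennreal\<close> loses nothing: on
    \<open>X\<close> each \<open>v n x\<close> will turn out to be a squared norm.\<close>
  define S where "S n = (SUP x\<in>X. ennreal (v n x))" for n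

  have residual: "\<exists>r. \<forall>x\<in>X. r x \<in> H \<and> (\<forall>x'\<in>X.
      cov_fun P (conditioned k (xs n) (y n) f) x x' = ip (r x) (r x') \<and>
      cov_fun Q (conditioned k (xs n) (y n) ft) x x' = (\<Sum>i<l. ip (\<psi> i) (r x) * ip (\<psi> i) (r x')))"
    for n
  proof -
    let ?N = "{..length (xs n)}"
    define p where "p x i = (xs n @ [x]) ! i" for x i
    \<comment> \<open>Each \<open>\<psi> i\<close> agrees with \<open>\<phi> i\<close> on
      \<open>X\<close> only, so all evaluation points have to stay in \<open>X\<close>.\<close>
    have pX: "p x i \<in> X" if "x \<in> X" "i \<in> ?N" for x i
    proof -
      have "(xs n @ [x]) ! i \<in> set (xs n @ [x])" using that(2) by (intro nth_mem) simp
      then show ?thesis using that(1) assms(13)[of n] by (auto simp: p_def)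
    qed
    \<comment> \<open>\<open>c\<close> and \<open>a\<close> are chosen before \<open>u\<close>, so
      the same weights serve every sample path of \<open>f\<close> and of \<open>ft\<close>.\<close>
    have "\<exists>c a. \<forall>u. u x + scalar_prod (kernel_vec k x (xs n))
        (the (mat_inverse (kernel_matrix k (xs n))) *\<^sub>v
          (y n - Matrix.vec (length (xs n)) (\<lambda>i. u (xs n ! i))))
      = c + (\<Sum>i\<in>?N. a i * u (p x i))" for x
      unfolding p_def by (rule conditioned_lincomb[OF assms(14,15), where x = x]) blast
    then obtain c a where ca: "\<forall>x u. u x + scalar_prod (kernel_vec k x (xs n))
        (the (mat_inverse (kernel_matrix k (xs n))) *\<^sub>v
          (y n - Matrix.vec (length (xs n)) (\<lambda>i. u (xs n ! i))))
      = c x + (\<Sum>i\<in>?N. a x i * u (p x i))"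
      by metis
    have cf: "conditioned k (xs n) (y n) f x = (\<lambda>\<omega>. c x + (\<Sum>i\<in>?N. a x i * f (p x i) \<omega>))"
      and cft: "conditioned k (xs n) (y n) ft x = (\<lambda>\<omega>. c x + (\<Sum>i\<in>?N. a x i * ft (p x i) \<omega>))" for x
      unfolding conditioned_def[abs_def] observe_def
      using ca[rule_format, of "\<lambda>z. f z _" x] ca[rule_format, of "\<lambda>z. ft z _" x] by auto
    define r where "r x = (\<lambda>z. \<Sum>i\<in>?N. a x i * k z (p x i))" for x
    have rH: "r x \<in> H" for x
      unfolding r_def
      by (rule function_hilbert_space_lincomb(1)[OF H _ _ kH]) (simp_all add: kH)
    \<comment> \<open>By the reproducing property, pairing with \<open>r x\<close> applies the
      weights \<open>a x\<close> to the values of \<open>h\<close>.\<close>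
    have r_left: "ip (r x) h = (\<Sum>i\<in>?N. a x i * h (p x i))" if "h \<in> H" for x h
    proof -
      have "ip (r x) h = (\<Sum>i\<in>?N. a x i * ip (\<lambda>z. k z (p x i)) h)"
        unfolding r_def
        by (rule function_hilbert_space_lincomb(2)[OF H _ _ that]) (simp_all add: kH)
      then show ?thesis using that repr comm kH by simp
    qed
    have P_cov: "cov_fun P (conditioned k (xs n) (y n) f) x x' = ip (r x) (r x')" for x x'
    proof -
      have "cov_fun P (conditioned k (xs n) (y n) f) x x' =
          (\<Sum>i\<in>?N. \<Sum>j\<in>?N. a x i * a x' j * cov P (f (p x i)) (f (p x' j)))"
        unfolding cov_fun_def cf by (rule cov_lincomb) (simp_all add: assms(4) f_meas f_sq)
      also have "\<dots> = ip (r x) (r x')"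
        \<comment> \<open>With \<open>h\<close> taken to be \<open>r x'\<close>, its values at the
          points \<open>p x i\<close> produce the double kernel sum.\<close>
        unfolding r_left[OF rH] by (simp add: r_def cov_f sum_distrib_left mult.assoc)
      finally show ?thesis .
    qed
    have Q_cov: "cov_fun Q (conditioned k (xs n) (y n) ft) x x' =
        (\<Sum>i<l. ip (\<psi> i) (r x) * ip (\<psi> i) (r x'))" if "x \<in> X" "x' \<in> X" for x x'
    proof -
      \<comment> \<open>Regrouping by the random weights \<open>w i\<close> leaves as coefficient
        the weighted combination of values of \<open>\<phi> i\<close>, which is
        \<open>ip (\<psi> i) (r x)\<close>.\<close>
      have lin: "conditioned k (xs n) (y n) ft x = (\<lambda>\<omega>. c x + (\<Sum>i<l. ip (\<psi> i) (r x) * w i \<omega>))"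
        if x: "x \<in> X" for x
      proof -
        have "ip (\<psi> i) (r x) = (\<Sum>j\<in>?N. a x j * \<phi> i (p x j))" if "i < l" for i
          using that comm[OF \<psi>(1) rH] r_left[OF \<psi>(1)] \<psi>(2)[OF that pX[OF x]] by simp
        then have "(\<Sum>i<l. ip (\<psi> i) (r x) * w i \<omega>) = (\<Sum>j\<in>?N. a x j * ft (p x j) \<omega>)" for \<omega>
          unfolding ft sum_distrib_left
          by (subst sum.swap) (simp add: sum_distrib_left mult_ac)
        then show ?thesis unfolding cft by simp
      qed
      have "cov_fun Q (conditioned k (xs n) (y n) ft) x x' =
          (\<Sum>i<l. \<Sum>j<l. ip (\<psi> i) (r x) * ip (\<psi> j) (r x') * cov Q (w i) (w j))"
        unfolding cov_fun_def lin[OF that(1)] lin[OF that(2)]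
        by (rule cov_lincomb) (simp_all add: assms(9) w_meas w_sq)
      also have "\<dots> = (\<Sum>i<l. \<Sum>j<l. if i = j then ip (\<psi> i) (r x) * ip (\<psi> j) (r x') else 0)"
        by (intro sum.cong refl) (simp add: cov_indep_std_normal[OF assms(9) w])
      finally show ?thesis by simp
    qed
    show ?thesis using rH P_cov Q_cov by blast
  qed

  have bound: "ennreal \<bar>cov_fun Q (conditioned k (xs n) (y n) ft) x x'
      - cov_fun P (conditioned k (xs n) (y n) f) x x'\<bar> \<le> ennreal C * S n"
    if x: "x \<in> X" "x' \<in> X" for n x x'
  proof -
    obtain r where r: "\<And>x. x \<in> X \<Longrightarrow> r x \<in> H"
      and rP: "\<And>x x'. x \<in> X \<Longrightarrow> x' \<in> X \<Longrightarrow>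
        cov_fun P (conditioned k (xs n) (y n) f) x x' = ip (r x) (r x')"
      and rQ: "\<And>x x'. x \<in> X \<Longrightarrow> x' \<in> X \<Longrightarrow>
        cov_fun Q (conditioned k (xs n) (y n) ft) x x' = (\<Sum>i<l. ip (\<psi> i) (r x) * ip (\<psi> i) (r x'))"
      using residual[of n] by blast
    let ?s = "sqrt (ip (r x) (r x)) * sqrt (ip (r x') (r x'))"
    note CS = function_hilbert_space_Cauchy_Schwarz[OF H]
    \<comment> \<open>Cauchy--Schwarz is applied to each factor separately, so the norm of
      \<open>\<psi> i\<close> enters squared.\<close>
    have term_le: "\<bar>ip (\<psi> i) (r x) * ip (\<psi> i) (r x')\<bar> \<le> ip (\<psi> i) (\<psi> i) * ?s" if "i < l" for i
    proof -
      let ?q = "sqrt (ip (\<psi> i) (\<psi> i))"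
      have "\<bar>ip (\<psi> i) (r x)\<bar> * \<bar>ip (\<psi> i) (r x')\<bar>
          \<le> (?q * sqrt (ip (r x) (r x))) * (?q * sqrt (ip (r x') (r x')))"
        by (intro mult_mono CS \<psi>(1) r x that mult_nonneg_nonneg real_sqrt_ge_zero pos abs_ge_zero)
      also have "\<dots> = (?q * ?q) * ?s" by (simp only: mult_ac)
      also have "?q * ?q = ip (\<psi> i) (\<psi> i)" using pos[OF \<psi>(1)[OF that]] by simp
      finally show ?thesis by (simp add: abs_mult)
    qed
    have "\<bar>\<Sum>i<l. ip (\<psi> i) (r x) * ip (\<psi> i) (r x')\<bar> \<le> (\<Sum>i<l. ip (\<psi> i) (\<psi> i) * ?s)"
      by (rule order_trans[OF sum_abs sum_mono]) (simp add: term_le)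
    moreover have "\<bar>ip (r x) (r x')\<bar> \<le> ?s" using CS r x by blast
    ultimately have "\<bar>(\<Sum>i<l. ip (\<psi> i) (r x) * ip (\<psi> i) (r x')) - ip (r x) (r x')\<bar> \<le> C * ?s"
      by (simp add: C_def distrib_right sum_distrib_right)
    \<comment> \<open>A geometric mean is at most the maximum. The two squared norms are posterior
      variances, so an off-diagonal pair is controlled by diagonal values.\<close>
    also have "?s \<le> max (v n x) (v n x')"
    proof -
      let ?m = "max (ip (r x) (r x)) (ip (r x') (r x'))"
      have "?s \<le> sqrt ?m * sqrt ?m"
        by (intro mult_mono) (auto simp: pos r x le_max_iff_disj)
      also have "\<dots> = ?m" using pos[OF r[OF x(1)]] by (simp add: le_max_iff_disj)
      finally show ?thesis unfolding v_def using rP x by simp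
    qed
    finally have "\<bar>cov_fun Q (conditioned k (xs n) (y n) ft) x x'
        - cov_fun P (conditioned k (xs n) (y n) f) x x'\<bar> \<le> C * max (v n x) (v n x')"
      using C rP rQ x by simp
    then have "ennreal \<bar>cov_fun Q (conditioned k (xs n) (y n) ft) x x'
        - cov_fun P (conditioned k (xs n) (y n) f) x x'\<bar> \<le> ennreal C * ennreal (max (v n x) (v n x'))"
      using C by (simp add: ennreal_mult'[symmetric] ennreal_leI)
    also have "\<dots> \<le> ennreal C * S n"
      unfolding S_def max_def using x by (intro mult_left_mono) (auto intro: SUP_upper)
    finally show ?thesis .
  qed
  \<comment> \<open>\<open>C\<close> is finite and independent of \<open>n\<close>, so
    multiplication by it preserves the limit 0 in \<open>ennreal\<close>.\<close>
  have "(\<lambda>n. ennreal C * S n) \<longlonglongrightarrow> ennreal C * 0"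
    using assms(16) unfolding S_def v_def by (intro ennreal_tendsto_cmult) simp_all
  then have upper: "(\<lambda>n. ennreal C * S n) \<longlonglongrightarrow> 0" by (simp only: mult_zero_right)
  show ?thesis
  proof (rule tendsto_sandwich[OF _ _ tendsto_const upper])
    show "\<forall>\<^sub>F n in sequentially. (SUP (x, x')\<in>X \<times> X.
        ennreal \<bar>cov_fun Q (conditioned k (xs n) (y n) ft) x x'
          - cov_fun P (conditioned k (xs n) (y n) f) x x'\<bar>) \<le> ennreal C * S n"
    proof (intro always_eventually allI SUP_least)
      fix n and z :: "'m \<times> 'm" assume "z \<in> X \<times> X"
      then show "(case z of (x, x') \<Rightarrow> ennreal \<bar>cov_fun Q (conditioned k (xs n) (y n) ft) x x'
          - cov_fun P (conditioned k (xs n) (y n) f) x x'\<bar>) \<le> ennreal C * S n"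
        by (cases z) (simp only: prod.case mem_Times_iff fst_conv snd_conv bound)
    qed
  qed (simp only: zero_le eventually_True)
qed

end
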